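(* Let $H$ be a quasiparabolic subgroup of the finite Coxeter group $W$. Then the Poincaré series $\mathrm{PS}_{W/H}(q)$ is a divisor of $\mathrm{PS}_W(q)$ in $\mathbb Z[q]$.
   Context: $(W,S)$ is a Coxeter system with length function $\ell$; $R(W)$ is the set of reflections, i.e. conjugates in $W$ of elements of $S$. A quasiparabolic $W$-set is a $W$-set $X$ with $\mathrm{ht}:X\to\mathbb Z$ satisfying $|\mathrm{ht}(sx)-\mathrm{ht}(x)|\le1$ for $s\in S$, $x\in X$, and: (QP1) for $r\in R(W)$, $x\in X$, if $\mathrm{ht}(rx)=\mathrm{ht}(x)$ then $rx=x$; (QP2) for $r\in R(W)$, $x\in X$, $s\in S$, if $\mathrm{ht}(rx)>\mathrm{ht}(x)$ and $\mathrm{ht}(srx)<\mathrm{ht}(sx)$, then $rx=sx$. A subgroup $H\subset W$ is quasiparabolic if $W/H$ (left cosets) with height $\mathrm{ht}(wH)=\min_{v\in wH}\ell(v)$ is a quasiparabolic $W$-set. The Poincaré series are $\mathrm{PS}_{W/H}(q)=\sum_{x\in W/H}q^{\mathrm{ht}(x)}$ and $\mathrm{PS}_W(q)=\sum_{w\in W}q^{\ell(w)}$. *)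

theory Defs
  imports "HOL-Algebra.Group_Action" "HOL-Algebra.Left_Coset" "HOL-Algebra.Generated_Groups"
    "HOL-Computational_Algebra.Polynomial"
begin

text \<open>A Coxeter matrix on \<open>S\<close>, where the value \<open>0\<close> encodes \<open>m(s,t) = \<infinity>\<close>
  (no relation between \<open>s\<close> and \<open>t\<close>).\<close>

definition coxeter_matrix :: "'a set \<Rightarrow> ('a \<Rightarrow> 'a \<Rightarrow> nat) \<Rightarrow> bool" where
  "coxeter_matrix S m \<longleftrightarrow>
     (\<forall>s\<in>S. m s s = 1) \<and>
     (\<forall>s\<in>S. \<forall>t\<in>S. m s t = m t s) \<and>
     (\<forall>s\<in>S. \<forall>t\<in>S. s \<noteq> t \<longrightarrow> m s t \<noteq> 1)"

definition word_prod :: "('a, 'b) monoid_scheme \<Rightarrow> 'a list \<Rightarrow> 'a" where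
  "word_prod G ws = foldr (\<otimes>\<^bsub>G\<^esub>) ws \<one>\<^bsub>G\<^esub>"

text \<open>Deletion of one relator \<open>(st)^m(s,t)\<close> from a word over \<open>S\<close>.  Since \<open>ss\<close> is a relator
  for every \<open>s\<close>, formal inverses of letters are superfluous: the quotient of the free monoid
  on \<open>S\<close> by the equivalence closure of this relation (a congruence) is the group
  with generators \<open>S\<close> and relations \<open>(st)^m(s,t) = 1\<close> for \<open>m(s,t) < \<infinity>\<close>.\<close>

inductive delete_relator :: "'a set \<Rightarrow> ('a \<Rightarrow> 'a \<Rightarrow> nat) \<Rightarrow> 'a list \<Rightarrow> 'a list \<Rightarrow> bool"
  for S m where
  "\<lbrakk>u \<in> lists S; v \<in> lists S; s \<in> S; t \<in> S; m s t \<noteq> 0\<rbrakk> \<Longrightarrow>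
     delete_relator S m (u @ concat (replicate (m s t) [s, t]) @ v) (u @ v)"

text \<open>\<open>G\<close> is generated by \<open>S\<close>, and the kernel of the evaluation of words is exactly the
  congruence given by the Coxeter relations.\<close>

locale coxeter_system = group G for G (structure) and S +
  assumes S_subset: "S \<subseteq> carrier G"
    and generated: "generate G S = carrier G"
    and presented: "\<exists>m. coxeter_matrix S m \<and>
      (\<forall>u\<in>lists S. \<forall>v\<in>lists S.
         word_prod G u = word_prod G v \<longleftrightarrow> equivclp (delete_relator S m) u v)"

definition cox_length :: "('a, 'b) monoid_scheme \<Rightarrow> 'a set \<Rightarrow> 'a \<Rightarrow> nat" where
  "cox_length G S w = (LEAST n. \<exists>ws\<in>lists S. length ws = n \<and> word_prod G ws = w)"

definition reflections :: "('a, 'b) monoid_scheme \<Rightarrow> 'a set \<Rightarrow> 'a set" where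
  "reflections G S = {w \<otimes>\<^bsub>G\<^esub> s \<otimes>\<^bsub>G\<^esub> inv\<^bsub>G\<^esub> w | w s. w \<in> carrier G \<and> s \<in> S}"

locale quasiparabolic_set = coxeter_system G S + group_action G X \<phi>
  for G (structure) and S and X :: "'x set" and \<phi> +
  fixes ht :: "'x \<Rightarrow> int"
  assumes ht_step: "\<lbrakk>s \<in> S; x \<in> X\<rbrakk> \<Longrightarrow> \<bar>ht (\<phi> s x) - ht x\<bar> \<le> 1"
    and QP1: "\<lbrakk>r \<in> reflections G S; x \<in> X; ht (\<phi> r x) = ht x\<rbrakk> \<Longrightarrow> \<phi> r x = x"
    and QP2: "\<lbrakk>r \<in> reflections G S; x \<in> X; s \<in> S;
               ht (\<phi> r x) > ht x; ht (\<phi> s (\<phi> r x)) < ht (\<phi> s x)\<rbrakk> \<Longrightarrow> \<phi> r x = \<phi> s x"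

definition coset_ht :: "('a, 'b) monoid_scheme \<Rightarrow> 'a set \<Rightarrow> 'a set \<Rightarrow> nat" where
  "coset_ht G S C = (LEAST n. \<exists>v\<in>C. cox_length G S v = n)"

text \<open>The action is restricted to the set of cosets because \<^const>\<open>BijGroup\<close> consists of
  extensional maps.\<close>

definition coset_action :: "('a, 'b) monoid_scheme \<Rightarrow> 'a set \<Rightarrow> 'a \<Rightarrow> 'a set \<Rightarrow> 'a set" where
  "coset_action G H w = (\<lambda>C \<in> lcosets\<^bsub>G\<^esub> H. w <#\<^bsub>G\<^esub> C)"

definition quasiparabolic_subgroup :: "('a, 'b) monoid_scheme \<Rightarrow> 'a set \<Rightarrow> 'a set \<Rightarrow> bool" where
  "quasiparabolic_subgroup G S H \<longleftrightarrow>
     subgroup H G \<and>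
     quasiparabolic_set G S (lcosets\<^bsub>G\<^esub> H) (coset_action G H) (\<lambda>C. int (coset_ht G S C))"

text \<open>Generating function of a height function on a finite set.\<close>

definition poincare_poly :: "'x set \<Rightarrow> ('x \<Rightarrow> nat) \<Rightarrow> int poly" where
  "poincare_poly X ht = (\<Sum>x\<in>X. monom 1 (ht x))"

end

theory Submission
  imports Defs
begin

text \<open>The Hecke algebra of \<open>W\<close> acts on the functions \<open>X \<rightarrow> \<int>[q]\<close>, where \<open>X = W/H\<close>.  Let \<open>E\<close> be the
  sum of all its standard basis elements and \<open>\<lambda>(f) = (E f)(x\<^sub>0)\<close> with \<open>x\<^sub>0 = H\<close>.  Then \<open>\<lambda>\<close>
  satisfies \<open>\<lambda>(T\<^sub>s f) = q \<lambda>(f)\<close>, which forces \<open>\<lambda>\<close> to take the same value \<open>c\<close> on all indicator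
  functions of points, so \<open>\<lambda>(f) = c \<Sum>\<^sub>x f(x)\<close>.  Evaluating at the eigenfunction \<open>x \<mapsto> q\<close> to the
  power \<open>ht x\<close>, on which \<open>T\<^sub>w\<close> acts by \<open>q\<close> to the power \<open>\<ell>(w)\<close>, gives \<open>PS\<^sub>W = c PS\<^sub>X\<close>.

  The braid relations are checked on the orbits of each dihedral subgroup \<open>\<langle>s, t\<rangle>\<close>.  Let \<open>k\<close> be
  the size of the orbit of \<open>st\<close> on a point of minimal height.  By QP1 and QP2 the alternating paths
  from this point ascend until they meet or get stuck, which gives the braid relation of length \<open>k\<close> at this
  point; the quadratic relation propagates it along the orbit, and \<open>k\<close> divides the order of \<open>st\<close>.\<close>

section \<open>Words in a group\<close>

lemma word_prod_Nil [simp]: "word_prod G [] = \<one>\<^bsub>G\<^esub>"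
  and word_prod_Cons [simp]: "word_prod G (s # ws) = s \<otimes>\<^bsub>G\<^esub> word_prod G ws"
  by (simp_all add: word_prod_def)

context group
begin

lemma word_prod_closed [simp, intro]: "set ws \<subseteq> carrier G \<Longrightarrow> word_prod G ws \<in> carrier G"
  by (induction ws) auto

lemma word_prod_append:
  "\<lbrakk>set u \<subseteq> carrier G; set v \<subseteq> carrier G\<rbrakk>
    \<Longrightarrow> word_prod G (u @ v) = word_prod G u \<otimes> word_prod G v"
  by (induction u) (auto simp: m_assoc)

end

fun alt :: "'a \<Rightarrow> 'a \<Rightarrow> nat \<Rightarrow> 'a list" where
  "alt s t 0 = []"
| "alt s t (Suc n) = s # alt t s n"

abbreviation alt_letter :: "'a \<Rightarrow> 'a \<Rightarrow> nat \<Rightarrow> 'a" where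
  "alt_letter s t n \<equiv> (if even n then s else t)"

lemma length_alt [simp]: "length (alt s t n) = n"
  by (induction n arbitrary: s t) auto

lemma set_alt: "set (alt s t n) \<subseteq> {s, t}"
  by (induction n arbitrary: s t) fastforce+

lemma alt_snoc: "alt s t (Suc n) = alt s t n @ [alt_letter s t n]"
  by (induction n arbitrary: s t) auto

lemma alt_add:
  "alt s t (m + n) = alt s t m @ alt (alt_letter s t m) (alt_letter t s m) n"
  by (induction m arbitrary: s t) auto

lemma take_alt: "i \<le> n \<Longrightarrow> take i (alt s t n) = alt s t i"
proof (induction n arbitrary: s t i)
  case (Suc n)
  then show ?case
    by (cases i) auto
qed simp

text \<open>For involutions, inverting \<open>alt t s n\<close> reverses it, and the reversal
  continues \<open>alt s t n\<close> to an alternating word of \<open>2 * n\<close> letters.\<close>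

lemma (in group) word_prod_alt_quotient:
  assumes "s \<in> carrier G" "t \<in> carrier G" "s \<otimes> s = \<one>" "t \<otimes> t = \<one>"
  shows "word_prod G (alt s t n) \<otimes> inv (word_prod G (alt t s n)) = (s \<otimes> t) [^] n"
  using assms
proof (induction n arbitrary: s t)
  case (Suc n)
  let ?A = "word_prod G (alt s t n)" and ?B = "word_prod G (alt t s n)"
  have closed [simp]: "?A \<in> carrier G" "?B \<in> carrier G"
    using Suc.prems set_alt[of s t n] set_alt[of t s n] by auto
  have "inv t = t"
    using Suc.prems inv_equality by blast
  then have "word_prod G (alt s t (Suc n)) \<otimes> inv (word_prod G (alt t s (Suc n)))
      = s \<otimes> (?B \<otimes> inv ?A) \<otimes> t"
    using Suc.prems by (simp add: inv_mult_group m_assoc)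
  also have "\<dots> = s \<otimes> (t \<otimes> s) [^] n \<otimes> t"
    using Suc by simp
  also have "\<dots> = (s \<otimes> t) [^] Suc n"
  proof (induction n)
    case (Suc k)
    have "s \<otimes> (t \<otimes> s) [^] Suc k \<otimes> t = (s \<otimes> (t \<otimes> s) [^] k \<otimes> t) \<otimes> (s \<otimes> t)"
      using \<open>s \<in> carrier G\<close> \<open>t \<in> carrier G\<close> by (simp add: m_assoc)
    then show ?case
      using Suc by simp
  qed (use Suc.prems in simp)
  finally show ?case .
qed simp

lemma (in group) word_prod_alt_eq_iff:
  assumes "s \<in> carrier G" "t \<in> carrier G" "s \<otimes> s = \<one>" "t \<otimes> t = \<one>"
  shows "word_prod G (alt s t n) = word_prod G (alt t s n) \<longleftrightarrow> (s \<otimes> t) [^] n = \<one>"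
proof -
  have "word_prod G (alt s t n) \<in> carrier G" "word_prod G (alt t s n) \<in> carrier G"
    using assms set_alt[of s t n] set_alt[of t s n] by auto
  then show ?thesis
    using word_prod_alt_quotient[OF assms, of n] by (metis inv_equality inv_inv inv_closed r_inv)
qed

section \<open>The exchange condition and Matsumoto's theorem\<close>

text \<open>The parity of the number of occurrences of \<open>r\<close> in the sequence
  \<open>s\<^sub>1, s\<^sub>1 s\<^sub>2 s\<^sub>1, s\<^sub>1 s\<^sub>2 s\<^sub>3 s\<^sub>2 s\<^sub>1, \<dots>\<close> of reflections attached to the word
  \<open>s\<^sub>1 s\<^sub>2 s\<^sub>3 \<dots>\<close>.\<close>

fun refl_parity :: "('a, 'b) monoid_scheme \<Rightarrow> 'a list \<Rightarrow> 'a \<Rightarrow> bool" where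
  "refl_parity G [] r = False"
| "refl_parity G (s # ws) r = ((r = s) \<noteq> refl_parity G ws (s \<otimes>\<^bsub>G\<^esub> r \<otimes>\<^bsub>G\<^esub> s))"

context coxeter_system
begin

lemma S_closed [simp, intro]: "s \<in> S \<Longrightarrow> s \<in> carrier G"
  using S_subset by auto

lemma lists_S_carrier: "ws \<in> lists S \<Longrightarrow> set ws \<subseteq> carrier G"
  using S_subset by auto

lemma word_prod_S_closed [simp, intro]: "ws \<in> lists S \<Longrightarrow> word_prod G ws \<in> carrier G"
  using S_subset by auto

lemma alt_in_lists [simp, intro]: "\<lbrakk>s \<in> S; t \<in> S\<rbrakk> \<Longrightarrow> alt s t n \<in> lists S"
  using set_alt[of s t n] by auto

lemma word_prod_append_S:
  "\<lbrakk>u \<in> lists S; v \<in> lists S\<rbrakk> \<Longrightarrow> word_prod G (u @ v) = word_prod G u \<otimes> word_prod G v"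
  using word_prod_append lists_S_carrier by blast

section \<open>Relators, involutions and reflection parity\<close>

lemma relator_eq_one:
  assumes "coxeter_matrix S m"
    and "\<forall>u\<in>lists S. \<forall>v\<in>lists S. word_prod G u = word_prod G v \<longleftrightarrow> equivclp (delete_relator S m) u v"
    and "s \<in> S" "t \<in> S" "m s t \<noteq> 0"
  shows "word_prod G (concat (replicate (m s t) [s, t])) = \<one>"
proof -
  have "delete_relator S m ([] @ concat (replicate (m s t) [s, t]) @ []) ([] @ [])"
    using assms by (intro delete_relator.intros) auto
  then have "equivclp (delete_relator S m) (concat (replicate (m s t) [s, t])) []"
    by auto
  moreover have "concat (replicate (m s t) [s, t]) \<in> lists S"
    using assms by auto
  ultimately show ?thesis
    using assms(2) by (metis lists.Nil word_prod_Nil)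
qed

lemma S_square [simp]:
  assumes "s \<in> S"
  shows "s \<otimes> s = \<one>"
proof -
  obtain m where m: "coxeter_matrix S m"
    "\<forall>u\<in>lists S. \<forall>v\<in>lists S. word_prod G u = word_prod G v \<longleftrightarrow> equivclp (delete_relator S m) u v"
    using presented by blast
  then have "m s s = 1"
    using assms by (simp add: coxeter_matrix_def)
  then show ?thesis
    using relator_eq_one[OF m assms assms] assms by simp
qed

lemma S_inv [simp]: "s \<in> S \<Longrightarrow> inv s = s"
  by (simp add: inv_equality)

lemma S_cancel [simp]: "\<lbrakk>s \<in> S; g \<in> carrier G\<rbrakk> \<Longrightarrow> s \<otimes> (s \<otimes> g) = g"
  by (simp flip: m_assoc)

lemma S_cancel_right [simp]: "\<lbrakk>s \<in> S; g \<in> carrier G\<rbrakk> \<Longrightarrow> g \<otimes> s \<otimes> s = g"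
  by (simp add: m_assoc)

text \<open>Cocycle identity: inside \<open>u @ v\<close>, the reflections attached to
  \<open>v\<close> appear conjugated by the product of \<open>u\<close>.\<close>

lemma refl_parity_append:
  assumes "u \<in> lists S" "v \<in> lists S" "r \<in> carrier G"
  shows "refl_parity G (u @ v) r =
    (refl_parity G u r \<noteq> refl_parity G v (inv (word_prod G u) \<otimes> r \<otimes> word_prod G u))"
  using assms
proof (induction u arbitrary: r)
  case (Cons s u)
  then have s: "s \<in> S" "word_prod G u \<in> carrier G" by auto
  have "inv (word_prod G u) \<otimes> (s \<otimes> r \<otimes> s) \<otimes> word_prod G u
      = inv (word_prod G (s # u)) \<otimes> r \<otimes> word_prod G (s # u)"
    using s Cons.prems by (simp add: inv_mult_group m_assoc)
  then show ?case
    using Cons s by auto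
qed auto

lemma word_prod_replicate:
  "\<lbrakk>s \<in> S; t \<in> S\<rbrakk> \<Longrightarrow> word_prod G (concat (replicate n [s, t])) = (s \<otimes> t) [^] n"
proof (induction n)
  case (Suc n)
  then show ?case
    using nat_pow_Suc2[of "s \<otimes> t" n] by (simp add: m_assoc)
qed simp

text \<open>The reflections attached to this word are
  \<open>(s \<otimes> t) [^] k \<otimes> s\<close> for \<open>k < 2 * n\<close>, in this
  order.\<close>

lemma refl_parity_replicate:
  assumes "s \<in> S" "t \<in> S" "r \<in> carrier G"
  shows "refl_parity G (concat (replicate n [s, t])) r \<longleftrightarrow>
    odd (\<Sum>k<2*n. if r = (s \<otimes> t) [^] k \<otimes> s then 1 else (0::nat))"
  using assms(3)
proof (induction n arbitrary: r)
  case (Suc n)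
  let ?z = "s \<otimes> t"
  let ?f = "\<lambda>k. if r = ?z [^] k \<otimes> s then 1 else (0::nat)"
  have z [simp]: "?z \<in> carrier G" using assms by simp
  have shift: "t \<otimes> (s \<otimes> r \<otimes> s) \<otimes> t = ?z [^] k \<otimes> s \<longleftrightarrow> r = ?z [^] Suc (Suc k) \<otimes> s" for k
  proof -
    have "t \<otimes> (s \<otimes> r \<otimes> s) \<otimes> t = ?z [^] k \<otimes> s \<longleftrightarrow>
        ?z \<otimes> (t \<otimes> (s \<otimes> r \<otimes> s) \<otimes> t) \<otimes> (t \<otimes> s) = ?z \<otimes> (?z [^] k \<otimes> s) \<otimes> (t \<otimes> s)"
      using assms Suc.prems by simp
    moreover have "?z \<otimes> (t \<otimes> (s \<otimes> r \<otimes> s) \<otimes> t) \<otimes> (t \<otimes> s) = r"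
      using assms Suc.prems by (simp add: m_assoc)
    moreover have "?z \<otimes> (?z [^] k \<otimes> s) \<otimes> (t \<otimes> s) = ?z [^] Suc (Suc k) \<otimes> s"
    proof -
      have "?z [^] Suc (Suc k) \<otimes> s = ?z \<otimes> ?z [^] Suc k \<otimes> s"
        using nat_pow_Suc2[OF z, of "Suc k"] by simp
      then show ?thesis
        using assms by (simp add: m_assoc)
    qed
    ultimately show ?thesis by metis
  qed
  have "refl_parity G (concat (replicate (Suc n) [s, t])) r \<longleftrightarrow>
      ((r = s) \<noteq> ((s \<otimes> r \<otimes> s = t) \<noteq>
        refl_parity G (concat (replicate n [s, t])) (t \<otimes> (s \<otimes> r \<otimes> s) \<otimes> t)))"
    by simp
  also have "refl_parity G (concat (replicate n [s, t])) (t \<otimes> (s \<otimes> r \<otimes> s) \<otimes> t) \<longleftrightarrow>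
      odd (\<Sum>k<2*n. ?f (Suc (Suc k)))"
    using Suc.IH[of "t \<otimes> (s \<otimes> r \<otimes> s) \<otimes> t"] Suc.prems assms by (simp only: shift m_closed S_closed)
  also have "s \<otimes> r \<otimes> s = t \<longleftrightarrow> r = ?z [^] Suc 0 \<otimes> s"
  proof -
    have "s \<otimes> (s \<otimes> r \<otimes> s) \<otimes> s = r"
      using assms Suc.prems by (simp add: m_assoc)
    moreover have "s \<otimes> (?z \<otimes> s) \<otimes> s = t"
      using assms by (simp add: m_assoc)
    ultimately show ?thesis
      using assms Suc.prems by (auto simp: m_assoc)
  qed
  also have "r = s \<longleftrightarrow> r = ?z [^] (0::nat) \<otimes> s"
    using assms by simp
  finally show ?case
    by (simp only: mult_Suc_right add_2_eq_Suc sum.lessThan_Suc_shift) auto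
qed simp

text \<open>The attached reflections repeat with period \<open>n\<close>, so each occurs equally
  often in the two halves of the sequence.\<close>

lemma refl_parity_relator:
  assumes "s \<in> S" "t \<in> S" "r \<in> carrier G" "(s \<otimes> t) [^] (n::nat) = \<one>"
  shows "\<not> refl_parity G (concat (replicate n [s, t])) r"
proof -
  let ?f = "\<lambda>k. if r = (s \<otimes> t) [^] k \<otimes> s then 1 else (0::nat)"
  have "?f (k + n) = ?f k" for k
    using assms nat_pow_mult[of "s \<otimes> t" k n] by simp
  moreover have "(\<Sum>k<j + n. ?f k) = (\<Sum>k<n. ?f k) + (\<Sum>k<j. ?f (k + n))" for j
    by (induction j) (simp_all only: add_Suc add_0 sum.lessThan_Suc lessThan_0 sum.empty
        add.right_neutral add.assoc)
  ultimately have "even (\<Sum>k<2*n. ?f k)"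
    by (simp only: mult_2) simp
  then show ?thesis
    using refl_parity_replicate[OF assms(1-3), of n] by simp
qed

text \<open>Words with equal product are joined by insertions and deletions of relators. By the
  cocycle identity a relator, having trivial product, leaves the rest unchanged, and its own count
  is even.\<close>

lemma refl_parity_cong:
  assumes "u \<in> lists S" "v \<in> lists S" "word_prod G u = word_prod G v" "r \<in> carrier G"
  shows "refl_parity G u r = refl_parity G v r"
proof -
  obtain m where m: "coxeter_matrix S m"
    "\<forall>u\<in>lists S. \<forall>v\<in>lists S. word_prod G u = word_prod G v \<longleftrightarrow> equivclp (delete_relator S m) u v"
    using presented by blast
  have step: "refl_parity G u r = refl_parity G v r" if "delete_relator S m u v" for u v
    using that
  proof cases
    case (1 a b s t)
    let ?R = "concat (replicate (m s t) [s, t])"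
    have R: "?R \<in> lists S" "word_prod G ?R = \<one>"
      using relator_eq_one[OF m] 1 by auto
    then have "(s \<otimes> t) [^] m s t = \<one>"
      using word_prod_replicate 1 by simp
    then show ?thesis
      using 1 R assms refl_parity_relator[of s t "inv (word_prod G a) \<otimes> r \<otimes> word_prod G a"]
      by (simp add: refl_parity_append)
  qed
  have "equivclp (delete_relator S m) u v"
    using m assms by blast
  then show ?thesis
    by (induction rule: equivclp_induct) (use step in auto)
qed

text \<open>An odd count is nonzero, so \<open>r\<close> is the conjugate of some letter by the
  prefix before it; left multiplication by \<open>r\<close> deletes that letter.\<close>

lemma word_deletion:
  assumes "u \<in> lists S" "r \<in> carrier G" "refl_parity G u r"
  shows "\<exists>i<length u. r \<otimes> word_prod G (take i u) = word_prod G (take (Suc i) u) \<and>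
    r \<otimes> word_prod G u = word_prod G (take i u @ drop (Suc i) u)"
  using assms
proof (induction u arbitrary: r)
  case (Cons s u)
  then have s: "s \<in> S" "u \<in> lists S" by auto
  show ?case
  proof (cases "r = s")
    case True
    then show ?thesis
      using s by (intro exI[of _ 0]) simp
  next
    case False
    then obtain i where i: "i < length u"
      "(s \<otimes> r \<otimes> s) \<otimes> word_prod G (take i u) = word_prod G (take (Suc i) u)"
      "(s \<otimes> r \<otimes> s) \<otimes> word_prod G u = word_prod G (take i u @ drop (Suc i) u)"
      using Cons.IH[of "s \<otimes> r \<otimes> s"] Cons.prems s by auto
    have move: "r \<otimes> (s \<otimes> g) = s \<otimes> ((s \<otimes> r \<otimes> s) \<otimes> g)" if "g \<in> carrier G" for g
      using that Cons.prems s by (simp add: m_assoc)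
    have "take i u \<in> lists S"
      using s set_take_subset[of i u] by auto
    then show ?thesis
      using i s by (intro exI[of _ "Suc i"]) (simp add: move)
  qed
qed simp

lemma ex_word:
  assumes "w \<in> carrier G"
  shows "\<exists>ws\<in>lists S. word_prod G ws = w"
proof -
  have "w \<in> generate G S"
    using assms generated by simp
  then show ?thesis
  proof (induction rule: generate.induct)
    case one
    then show ?case by (intro bexI[of _ "[]"]) auto
  next
    case (incl h)
    then show ?case by (intro bexI[of _ "[h]"]) auto
  next
    case (inv h)
    then show ?case by (intro bexI[of _ "[h]"]) auto
  next
    case (eng h1 h2)
    then show ?case
      using word_prod_append_S by (metis append_in_lists_conv)
  qed
qed

section \<open>Length, reduced words and exchange\<close>

abbreviation len :: "'a \<Rightarrow> nat" where
  "len \<equiv> cox_length G S"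

definition reduced :: "'a list \<Rightarrow> bool" where
  "reduced ws \<longleftrightarrow> ws \<in> lists S \<and> len (word_prod G ws) = length ws"

lemma len_le: "ws \<in> lists S \<Longrightarrow> len (word_prod G ws) \<le> length ws"
  unfolding cox_length_def by (rule Least_le) auto

lemma ex_reduced:
  assumes "w \<in> carrier G"
  shows "\<exists>ws. reduced ws \<and> word_prod G ws = w"
proof -
  have "\<exists>n. \<exists>ws\<in>lists S. length ws = n \<and> word_prod G ws = w"
    using ex_word[OF assms] by auto
  from LeastI_ex[OF this] show ?thesis
    by (auto simp: reduced_def cox_length_def)
qed

lemma len_one [simp]: "len \<one> = 0"
  using len_le[of "[]"] by simp

lemma reduced_Cons:
  assumes "reduced (s # u)"
  shows "s \<in> S" "reduced u" "len (s \<otimes> (s \<otimes> word_prod G u)) < len (s \<otimes> word_prod G u)"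
proof -
  have *: "s \<in> S" "u \<in> lists S" "len (s \<otimes> word_prod G u) = Suc (length u)"
    using assms by (auto simp: reduced_def)
  obtain v where v: "reduced v" "word_prod G v = word_prod G u"
    using ex_reduced * by blast
  then have "len (word_prod G (s # v)) \<le> length (s # v)"
    using * by (intro len_le) (auto simp: reduced_def)
  then have "length u \<le> len (word_prod G u)"
    using v * by (auto simp: reduced_def)
  then show "s \<in> S" "reduced u" "len (s \<otimes> (s \<otimes> word_prod G u)) < len (s \<otimes> word_prod G u)"
    using * len_le[of u] by (auto simp: reduced_def)
qed

text \<open>Take a reduced \<open>v\<close> for the product of \<open>s # u\<close>. If
  \<open>s\<close> were odd in \<open>v\<close>, deletion would make the product of \<open>u\<close>
  shorter than \<open>v\<close>, against the assumption. So \<open>s\<close> is odd in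
  \<open>s # v\<close>, which has the same product as \<open>u\<close>.\<close>

lemma refl_parity_descent:
  assumes "u \<in> lists S" "s \<in> S" "len (s \<otimes> word_prod G u) \<le> len (word_prod G u)"
  shows "refl_parity G u s"
proof -
  obtain v where v: "reduced v" "word_prod G v = s \<otimes> word_prod G u"
    using ex_reduced[of "s \<otimes> word_prod G u"] assms by auto
  have vS: "v \<in> lists S"
    using v by (simp add: reduced_def)
  have "\<not> refl_parity G v s"
  proof
    assume "refl_parity G v s"
    then obtain i where i: "i < length v" "s \<otimes> word_prod G v = word_prod G (take i v @ drop (Suc i) v)"
      using word_deletion[of v s] vS assms by blast
    have "take i v @ drop (Suc i) v \<in> lists S"
      using vS set_take_subset[of i v] set_drop_subset[of "Suc i" v] by auto
    then have "len (s \<otimes> word_prod G v) < length v"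
      using i len_le by fastforce
    then have "len (word_prod G u) < length v"
      using v(2) assms by simp
    then show False
      using v assms by (simp add: reduced_def)
  qed
  then have "refl_parity G (s # v) s"
    using assms by simp
  then show ?thesis
    using refl_parity_cong[of "s # v" u s] vS v assms by simp
qed

text \<open>With equal lengths, \<open>s\<close> would be odd both in \<open>u\<close> and in
  \<open>s # u\<close>, but a prepended \<open>s\<close> flips its own parity.\<close>

lemma len_mult_neq:
  assumes "s \<in> S" "w \<in> carrier G"
  shows "len (s \<otimes> w) \<noteq> len w"
proof
  assume eq: "len (s \<otimes> w) = len w"
  obtain u where u: "u \<in> lists S" "word_prod G u = w"
    using ex_word assms by blast
  then have "refl_parity G u s" "refl_parity G (s # u) s"
    using refl_parity_descent[of u s] refl_parity_descent[of "s # u" s] eq assms by simp_all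
  then show False
    using assms by simp
qed

lemma len_mult_le:
  assumes "s \<in> S" "w \<in> carrier G"
  shows "len (s \<otimes> w) \<le> Suc (len w)"
proof -
  obtain u where "reduced u" "word_prod G u = w"
    using ex_reduced assms by blast
  then show ?thesis
    using len_le[of "s # u"] assms by (auto simp: reduced_def)
qed

lemma reduced_ConsI:
  assumes "s \<in> S" "reduced u" "len (word_prod G u) < len (s \<otimes> word_prod G u)"
  shows "reduced (s # u)"
  using assms len_mult_le[of s "word_prod G u"] by (auto simp: reduced_def)

text \<open>The equation between prefixes locates the exchanged letter; it later shows that this
  letter lies outside an alternating prefix.\<close>

lemma exchange:
  assumes "reduced u" "s \<in> S" "len (s \<otimes> word_prod G u) < len (word_prod G u)"
  obtains i where "i < length u"
    "s \<otimes> word_prod G (take i u) = word_prod G (take (Suc i) u)"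
    "reduced (s # take i u @ drop (Suc i) u)"
    "word_prod G (s # take i u @ drop (Suc i) u) = word_prod G u"
proof -
  have u: "u \<in> lists S"
    using assms by (simp add: reduced_def)
  obtain i where i: "i < length u" "s \<otimes> word_prod G (take i u) = word_prod G (take (Suc i) u)"
    "s \<otimes> word_prod G u = word_prod G (take i u @ drop (Suc i) u)"
    using word_deletion[OF u, of s] refl_parity_descent[OF u assms(2)] assms by auto
  moreover have "word_prod G (s # take i u @ drop (Suc i) u) = word_prod G u"
    using assms(2) u by (simp flip: i(3))
  moreover have "take i u @ drop (Suc i) u \<in> lists S"
    using u set_take_subset[of i u] set_drop_subset[of "Suc i" u] by auto
  ultimately show thesis
    using that[of i] assms by (auto simp: reduced_def)
qed

text \<open>While \<open>j\<close> is smaller than the order of \<open>st\<close>, the letter exchanged for \<open>t\<close> cannot lie in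
  the alternating prefix: this would give \<open>(st)^i = 1\<close> for some \<open>0 < i \<le> j\<close>.\<close>

lemma alternating_prefix_step:
  assumes "s \<in> S" "t \<in> S" "w \<in> carrier G" "len (t \<otimes> w) < len w"
    and "reduced (alt s t j @ u)" "word_prod G (alt s t j @ u) = w"
    and "\<forall>i. 0 < i \<and> i \<le> j \<longrightarrow> (s \<otimes> t) [^] i \<noteq> \<one>"
  shows "\<exists>v. reduced (alt t s (Suc j) @ v) \<and> word_prod G (alt t s (Suc j) @ v) = w"
proof -
  obtain i where i: "i < length (alt s t j @ u)"
    "t \<otimes> word_prod G (take i (alt s t j @ u)) = word_prod G (take (Suc i) (alt s t j @ u))"
    "reduced (t # take i (alt s t j @ u) @ drop (Suc i) (alt s t j @ u))"
    "word_prod G (t # take i (alt s t j @ u) @ drop (Suc i) (alt s t j @ u)) = w"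
    using exchange[OF assms(5,2)] assms(4,6) by metis
  have "\<not> i < j"
  proof
    assume "i < j"
    then have "word_prod G (alt t s (Suc i)) = word_prod G (alt s t (Suc i))"
      using i(2) by (simp add: take_alt)
    then have "(s \<otimes> t) [^] Suc i = \<one>"
      using word_prod_alt_eq_iff[of s t "Suc i"] assms(1,2) by simp
    then show False
      using assms(7) \<open>i < j\<close> by (metis Suc_leI zero_less_Suc)
  qed
  then show ?thesis
    using i(3,4) by (intro exI[of _ "take (i - j) u @ drop (Suc (i - j)) u"]) (simp add: Suc_diff_le)
qed

text \<open>Exchanging in the other letter lengthens an alternating prefix by one and changes its
  first letter, so both kinds of prefix grow together, up to the order of
  \<open>s \<otimes> t\<close>.\<close>

lemma two_descents:
  assumes "s \<in> S" "t \<in> S" "w \<in> carrier G" "len (s \<otimes> w) < len w" "len (t \<otimes> w) < len w"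
  obtains m u where "0 < m" "(s \<otimes> t) [^] m = \<one>"
    "reduced (alt s t m @ u)" "word_prod G (alt s t m @ u) = w"
proof -
  define P where "P s t j \<longleftrightarrow> (\<exists>u. reduced (alt s t j @ u) \<and> word_prod G (alt s t j @ u) = w)" for s t j
  have P: "P s t j \<and> P t s j" if "\<forall>i. 0 < i \<and> i < j \<longrightarrow> (s \<otimes> t) [^] i \<noteq> \<one>" for j
    using that
  proof (induction j)
    case 0
    then show ?case
      using ex_reduced assms(3) by (simp add: P_def)
  next
    case (Suc j)
    then have st: "\<forall>i. 0 < i \<and> i \<le> j \<longrightarrow> (s \<otimes> t) [^] i \<noteq> \<one>" and "P s t j" "P t s j"
      by auto
    moreover have "(t \<otimes> s) [^] i = \<one> \<longleftrightarrow> (s \<otimes> t) [^] i = \<one>" for i :: nat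
      using word_prod_alt_eq_iff[of s t i] word_prod_alt_eq_iff[of t s i] assms by auto
    ultimately show ?case
      using alternating_prefix_step[of s t w j] alternating_prefix_step[of t s w j] assms
      by (auto simp only: P_def)
  qed
  \<comment> \<open>Were all positive powers nontrivial, an alternating prefix would outgrow the
    length of \<open>w\<close>.\<close>
  have "\<exists>i::nat. 0 < i \<and> (s \<otimes> t) [^] i = \<one>"
  proof (rule ccontr)
    assume "\<not> ?thesis"
    then have "\<forall>i. 0 < i \<and> i < Suc (len w) \<longrightarrow> (s \<otimes> t) [^] i \<noteq> \<one>"
      by blast
    from P[OF this] have "P s t (Suc (len w))" ..
    then obtain u where "len w = length (alt s t (Suc (len w)) @ u)"
      unfolding P_def reduced_def by metis
    then show False
      by (simp del: alt.simps)
  qed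
  then obtain m :: nat where "0 < m" "(s \<otimes> t) [^] m = \<one>" "\<forall>i<m. \<not> (0 < i \<and> (s \<otimes> t) [^] i = \<one>)"
    using exists_least_iff[of "\<lambda>i::nat. 0 < i \<and> (s \<otimes> t) [^] i = \<one>"] by auto
  then show thesis
    using P[of m] that[of m] by (auto simp: P_def)
qed

text \<open>Both first letters are left descents of the common product, which therefore has reduced
  words starting with \<open>alt s t m\<close> and \<open>alt t s m\<close> and sharing a tail. One
  braid move joins these; words with equal first letters are compared by induction on the
  length.\<close>

theorem matsumoto:
  fixes f :: "'a \<Rightarrow> 'c \<Rightarrow> 'c"
  assumes braid: "\<And>s t n. \<lbrakk>s \<in> S; t \<in> S; (s \<otimes> t) [^] (n::nat) = \<one>\<rbrakk>
      \<Longrightarrow> fold f (alt s t n) = fold f (alt t s n)"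
    and "reduced u" "reduced v" "word_prod G u = word_prod G v"
  shows "fold f u = fold f v"
  using assms(2-4)
proof (induction "length u" arbitrary: u v)
  case 0
  then have "length v = length u"
    by (metis reduced_def)
  with 0 show ?case
    by simp
next
  case (Suc n)
  then have "length v = Suc n"
    by (metis reduced_def)
  then obtain s u' t v' where uv: "u = s # u'" "v = t # v'"
    using Suc.hyps by (metis length_Suc_conv)
  have same_head: "fold f (r # a) = fold f (r # b)"
    if "reduced (r # a)" "reduced (r # b)" "word_prod G (r # a) = word_prod G (r # b)"
      "length a = n" for r a b
  proof -
    have "word_prod G a = word_prod G b"
      using that by (auto simp: reduced_def)
    then show ?thesis
      using Suc.hyps(1)[of a b] that reduced_Cons(2) by simp
  qed
  define w where "w = word_prod G u"
  have w: "w \<in> carrier G" "word_prod G v = w"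
    using Suc.prems by (auto simp: w_def reduced_def)
  have st: "s \<in> S" "t \<in> S" "len (s \<otimes> w) < len w" "len (t \<otimes> w) < len w"
    using reduced_Cons[of s u'] reduced_Cons[of t v'] Suc.prems uv w by (auto simp: w_def)
  then obtain m x where m: "0 < m" "(s \<otimes> t) [^] m = \<one>"
    "reduced (alt s t m @ x)" "word_prod G (alt s t m @ x) = w"
    using two_descents w by metis
  have x: "x \<in> lists S"
    using m by (simp add: reduced_def)
  have prod: "word_prod G (alt t s m @ x) = w"
    using m x st word_prod_alt_eq_iff[of s t m] by (simp add: word_prod_append_S)
  then have red: "reduced (alt t s m @ x)"
    using m st by (simp add: reduced_def)
  obtain k where k: "m = Suc k"
    using m by (cases m) auto
  have "fold f u = fold f (alt s t m @ x)"
    using same_head[of s u' "alt t s k @ x"] m k uv Suc.prems Suc.hyps w_def by simp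
  also have "\<dots> = fold f (alt t s m @ x)"
    using braid[OF st(1,2) m(2)] by simp
  also have "\<dots> = fold f v"
  proof -
    have "fold f (t # alt s t k @ x) = fold f (t # v')"
    proof (rule same_head)
      show "length (alt s t k @ x) = n"
        using red k Suc.hyps(2) Suc.prems(1) prod by (simp add: reduced_def w_def)
    qed (use red prod k uv Suc.prems w in simp_all)
    then show ?thesis
      using k uv by simp
  qed
  finally show ?case .
qed

end

section \<open>Hecke operators on quasiparabolic sets\<close>

context quasiparabolic_set
begin

lemma act_closed [simp, intro]: "\<lbrakk>g \<in> carrier G; x \<in> X\<rbrakk> \<Longrightarrow> \<phi> g x \<in> X"
  using element_image by blast

lemma act_one [simp]: "x \<in> X \<Longrightarrow> \<phi> \<one> x = x"
  by (metis id_eq_one restrict_apply')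

lemma act_S_twice [simp]: "\<lbrakk>s \<in> S; x \<in> X\<rbrakk> \<Longrightarrow> \<phi> s (\<phi> s x) = x"
  using composition_rule[of x s s] by simp

lemma S_reflection: "s \<in> S \<Longrightarrow> s \<in> reflections G S"
  unfolding reflections_def by (rule CollectI, rule exI[of _ \<one>], rule exI[of _ s]) simp

text \<open>Equal heights force a fixed point by QP1, so a point moved by \<open>s\<close> changes
  height by exactly one.\<close>

lemma ht_cases:
  assumes "s \<in> S" "x \<in> X"
  obtains "\<phi> s x = x" | "\<phi> s x \<noteq> x" "ht (\<phi> s x) = ht x + 1" | "\<phi> s x \<noteq> x" "ht (\<phi> s x) = ht x - 1"
  using ht_step[OF assms] QP1[OF S_reflection assms(2), of s] assms by fastforce

text \<open>These operators are the transposes of the action of the Hecke algebra generators on the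
  free module with basis \<open>X\<close>.  Outside \<open>X\<close> every generator acts by \<open>q\<close>, so that the quadratic
  and braid relations hold as equations between functions.\<close>

definition hecke_op :: "'r::idom \<Rightarrow> 'a \<Rightarrow> ('x \<Rightarrow> 'r) \<Rightarrow> 'x \<Rightarrow> 'r" where
  "hecke_op q s f x =
    (if x \<notin> X \<or> \<phi> s x = x then q * f x
     else if ht x < ht (\<phi> s x) then f (\<phi> s x)
     else (q - 1) * f x + q * f (\<phi> s x))"

lemma hecke_op_square:
  assumes "s \<in> S"
  shows "hecke_op q s (hecke_op q s f) = (\<lambda>x. (q - 1) * hecke_op q s f x + q * f x)"
proof
  fix x
  show "hecke_op q s (hecke_op q s f) x = (q - 1) * hecke_op q s f x + q * f x"
  proof (cases "x \<in> X")
    case True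
    show ?thesis
      using assms True
      by (cases rule: ht_cases[OF assms True]) (auto simp: hecke_op_def algebra_simps)
  qed (simp add: hecke_op_def algebra_simps)
qed

lemma hecke_op_linear:
  "hecke_op q s (\<lambda>x. a * f x + b * g x) = (\<lambda>x. a * hecke_op q s f x + b * hecke_op q s g x)"
  by (rule ext) (simp add: hecke_op_def algebra_simps)

lemma foldr_hecke_linear:
  "foldr (hecke_op q) ws (\<lambda>x. a * f x + b * g x) =
    (\<lambda>x. a * foldr (hecke_op q) ws f x + b * foldr (hecke_op q) ws g x)"
  by (induction ws) (simp_all add: hecke_op_linear)

lemma foldr_hecke_outside: "x \<notin> X \<Longrightarrow> foldr (hecke_op q) ws f x = q ^ length ws * f x"
  by (induction ws) (simp_all add: hecke_op_def)

lemma foldr_hecke_cong: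
  assumes "\<And>s x. \<lbrakk>s \<in> set ws; x \<in> U\<rbrakk> \<Longrightarrow> \<phi> s x \<in> U" "\<And>x. x \<in> U \<Longrightarrow> f x = g x" "x \<in> U"
  shows "foldr (hecke_op q) ws f x = foldr (hecke_op q) ws g x"
  using assms
proof (induction ws arbitrary: x)
  case (Cons s ws)
  then have "foldr (hecke_op q) ws f x = foldr (hecke_op q) ws g x"
    "foldr (hecke_op q) ws f (\<phi> s x) = foldr (hecke_op q) ws g (\<phi> s x)"
    by simp_all
  then show ?case
    using Cons.prems by (simp add: hecke_op_def[of q s])
qed simp

section \<open>Dihedral orbits and the braid relations\<close>

text \<open>The inverse makes the first letter act first: this is the path \<open>x\<close>,
  \<open>s x\<close>, \<open>t s x\<close>, and so on.\<close>

definition zig :: "'x \<Rightarrow> 'a \<Rightarrow> 'a \<Rightarrow> nat \<Rightarrow> 'x" where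
  "zig x s t n = \<phi> (inv (word_prod G (alt s t n))) x"

lemma zig_0 [simp]: "x \<in> X \<Longrightarrow> zig x s t 0 = x"
  by (simp add: zig_def)

lemma zig_closed [simp, intro]: "\<lbrakk>s \<in> S; t \<in> S; x \<in> X\<rbrakk> \<Longrightarrow> zig x s t n \<in> X"
  by (simp add: zig_def)

lemma zig_Suc:
  assumes "s \<in> S" "t \<in> S" "x \<in> X"
  shows "zig x s t (Suc n) = \<phi> (alt_letter s t n) (zig x s t n)"
proof -
  have "word_prod G (alt s t (Suc n)) = word_prod G (alt s t n) \<otimes> alt_letter s t n"
    using assms by (simp only: alt_snoc) (simp add: word_prod_append_S)
  then show ?thesis
    using assms unfolding zig_def
    by (simp add: inv_mult_group composition_rule del: alt.simps)
qed

lemma zig_Suc_shift: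
  assumes "s \<in> S" "t \<in> S" "x \<in> X"
  shows "zig x s t (Suc n) = zig (\<phi> s x) t s n"
  using assms by (simp add: zig_def inv_mult_group composition_rule)

text \<open>With \<open>u\<close> the inverse of the product of \<open>alt t s n\<close>, the two
  points are \<open>u s x\<close> and \<open>u x\<close>; the conjugate of \<open>s\<close> by
  \<open>u\<close> takes the second to the first.\<close>

lemma zig_reflection:
  assumes "s \<in> S" "t \<in> S" "x \<in> X"
  obtains r where "r \<in> reflections G S" "zig x s t (Suc n) = \<phi> r (zig x t s n)"
proof
  let ?u = "inv (word_prod G (alt t s n))"
  have u: "?u \<in> carrier G"
    using assms by simp
  show "?u \<otimes> s \<otimes> inv ?u \<in> reflections G S"
    using u assms unfolding reflections_def by blast
  have "zig x s t (Suc n) = \<phi> (?u \<otimes> s) x"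
    using assms by (simp add: zig_def inv_mult_group)
  also have "?u \<otimes> s = (?u \<otimes> s \<otimes> inv ?u) \<otimes> ?u"
    using assms u by (simp add: m_assoc)
  finally show "zig x s t (Suc n) = \<phi> (?u \<otimes> s \<otimes> inv ?u) (zig x t s n)"
    using assms u by (simp add: zig_def composition_rule)
qed

lemma zig_eq_iff:
  assumes "s \<in> S" "t \<in> S" "x \<in> X"
  shows "zig x s t n = zig x t s n \<longleftrightarrow> \<phi> ((s \<otimes> t) [^] n) x = x"
proof -
  let ?A = "word_prod G (alt s t n)" and ?B = "word_prod G (alt t s n)"
  have AB: "?A \<in> carrier G" "?B \<in> carrier G"
    using assms by auto
  have "\<phi> ((s \<otimes> t) [^] n) x = \<phi> ?A (zig x t s n)"
    using assms AB composition_rule[of x ?A "inv ?B"]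
    by (simp add: zig_def word_prod_alt_quotient)
  moreover have "\<phi> ?A (zig x s t n) = x"
    using assms AB composition_rule[of x ?A "inv ?A"] by (simp add: zig_def)
  moreover have "\<phi> (inv ?A) (\<phi> ?A (zig x t s n)) = zig x t s n"
    using assms AB composition_rule[of "zig x t s n" "inv ?A" ?A] by simp
  moreover have "\<phi> (inv ?A) x = zig x s t n"
    by (simp add: zig_def)
  ultimately show ?thesis by metis
qed

text \<open>A reflection maps \<open>zig x t s m\<close> to \<open>zig x s t (Suc m)\<close>, and the next letter takes the
  former up, so \<open>QP2\<close> forbids a descent from the latter before the two paths meet.\<close>

lemma zig_ascend:
  assumes st: "s \<in> S" "t \<in> S" "x \<in> X"
    and "ht (zig x s t (Suc m)) = ht (zig x t s m) + 1"
    and "ht (zig x t s (Suc m)) = ht (zig x s t (Suc m))"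
    and neq: "zig x s t (Suc m) \<noteq> zig x t s (Suc m)"
  shows "ht (zig x s t (Suc (Suc m))) = ht (zig x s t (Suc m)) + 1"
proof -
  define c where "c = alt_letter t s m"
  have c: "c \<in> S" "zig x s t (Suc (Suc m)) = \<phi> c (zig x s t (Suc m))"
    "zig x t s (Suc m) = \<phi> c (zig x t s m)"
    using st zig_Suc[OF st, of "Suc m"] zig_Suc[OF st(2,1,3), of m] by (auto simp: c_def)
  show ?thesis
  proof (cases rule: ht_cases[OF c(1) zig_closed[OF st, of "Suc m"]])
    \<comment> \<open>If \<open>c\<close> fixes the point, \<open>zig_reflection\<close> joins two
      points of equal height, and QP1 identifies them, contrary to \<open>neq\<close>.\<close>
    case 1
    obtain r where r: "r \<in> reflections G S" "zig x s t (Suc (Suc m)) = \<phi> r (zig x t s (Suc m))"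
      using zig_reflection[OF st] .
    then have "zig x s t (Suc (Suc m)) = zig x t s (Suc m)"
      using QP1[OF r(1) zig_closed[OF st(2,1,3), of "Suc m"]] 1 c assms by simp
    then show ?thesis
      using 1 c neq by simp
  next
    case 2
    then show ?thesis
      using c by simp
  next
    case 3
    obtain r where r: "r \<in> reflections G S" "zig x s t (Suc m) = \<phi> r (zig x t s m)"
      using zig_reflection[OF st] .
    have "\<phi> r (zig x t s m) = \<phi> c (zig x t s m)"
      using r 3 assms c by (intro QP2) auto
    then show ?thesis
      using r c neq by simp
  qed
qed

text \<open>Where a letter raises the height, its operator merely evaluates at the moved point,
  without any power of \<open>q\<close>.\<close>

lemma foldr_hecke_ascending:
  assumes "s \<in> S" "t \<in> S" "x \<in> X"
    and "\<And>n. n < k \<Longrightarrow> ht (zig x s t n) < ht (zig x s t (Suc n))"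
  shows "foldr (hecke_op q) (alt s t k) f x = f (zig x s t k)"
  using assms(4)
proof (induction k arbitrary: f)
  case (Suc k)
  let ?c = "alt_letter s t k"
  have "foldr (hecke_op q) (alt s t (Suc k)) f x = hecke_op q ?c f (zig x s t k)"
    using Suc by (simp only: alt_snoc) simp
  also have "\<dots> = f (zig x s t (Suc k))"
    using Suc.prems[of k] assms zig_Suc[OF assms(1-3), of k] by (auto simp: hecke_op_def)
  finally show ?case .
qed (use assms in simp)

text \<open>Both paths climb in step by \<open>zig_ascend\<close> until they first meet, so both
  sides are the value of \<open>f\<close> at the meeting point.\<close>

lemma braid_at_minimum_cycle:
  assumes st: "s \<in> S" "t \<in> S" "x \<in> X"
    and up: "ht x < ht (\<phi> s x)" "ht x < ht (\<phi> t x)"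
    and meet: "zig x s t k = zig x t s k"
    and least: "\<And>n. \<lbrakk>0 < n; n < k\<rbrakk> \<Longrightarrow> zig x s t n \<noteq> zig x t s n"
  shows "foldr (hecke_op q) (alt s t k) f x = foldr (hecke_op q) (alt t s k) f x"
proof -
  have first: "zig x s t (Suc 0) = \<phi> s x" "zig x t s (Suc 0) = \<phi> t x"
    using zig_Suc st by simp_all
  have rise: "ht (zig x s t n) = ht x + int n \<and> ht (zig x t s n) = ht x + int n" if "n \<le> k" for n
    using that
  proof (induction n rule: less_induct)
    case (less n)
    consider "n = 0" | "n = Suc 0" | m where "n = Suc (Suc m)"
      by (metis not0_implies_Suc)
    then show ?case
    proof cases
      case 1
      then show ?thesis
        using st by simp
    next
      case 2
      then show ?thesis
        using ht_step[of s x] ht_step[of t x] first st up by simp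
    next
      case 3
      then have "zig x s t (Suc m) \<noteq> zig x t s (Suc m)"
        using least[of "Suc m"] less.prems by simp
      then show ?thesis
        using zig_ascend[of s t x m] zig_ascend[of t s x m] st 3 less.prems
          less.IH[of m] less.IH[of "Suc m"] by simp
    qed
  qed
  then have "foldr (hecke_op q) (alt s t k) f x = f (zig x s t k)"
    "foldr (hecke_op q) (alt t s k) f x = f (zig x t s k)"
    using st by (auto intro!: foldr_hecke_ascending)
  then show ?thesis
    using meet by simp
qed

text \<open>Since \<open>s\<close> fixes \<open>x\<close>, the \<open>s\<close>-path is the
  \<open>t\<close>-path delayed by one step, and it climbs to a point fixed by the next letter. One
  side picks up its factor \<open>q\<close> at the bottom, the other at the top.\<close>

lemma braid_at_minimum_path:
  assumes st: "s \<in> S" "t \<in> S" "x \<in> X"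
    and fixed: "\<phi> s x = x" and up: "ht x \<le> ht (\<phi> t x)"
    and meet: "zig x s t (Suc k) = zig x t s (Suc k)"
    and least: "\<And>n. \<lbrakk>0 < n; n < Suc k\<rbrakk> \<Longrightarrow> zig x s t n \<noteq> zig x t s n"
  shows "foldr (hecke_op q) (alt s t (Suc k)) f x = foldr (hecke_op q) (alt t s (Suc k)) f x"
proof -
  let ?b = "zig x t s"
  have shift: "zig x s t (Suc n) = ?b n" for n
    using zig_Suc_shift st fixed by simp
  have rise: "ht (?b n) = ht x + int n" if "n \<le> k" for n
    using that
  proof (induction n rule: less_induct)
    case (less n)
    show ?case
    proof (cases n)
      case 0
      then show ?thesis
        using st by simp
    next
      case (Suc m)
      define c where "c = alt_letter t s m"
      have c: "c \<in> S" "?b (Suc m) = \<phi> c (?b m)"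
        using st zig_Suc[OF st(2,1,3), of m] by (auto simp: c_def)
      \<comment> \<open>Standing still would make the two paths meet before step
        \<open>Suc k\<close>.\<close>
      have neq: "?b (Suc m) \<noteq> ?b m"
        using least[of "Suc m"] shift[of m] Suc less.prems by simp
      show ?thesis
      proof (cases rule: ht_cases[OF c(1) zig_closed[OF st(2,1,3), of m]])
        case 1
        then show ?thesis
          using c neq by simp
      next
        case 2
        then show ?thesis
          using less.IH[of m] less.prems c Suc by simp
      next
        case 3
        show ?thesis
        proof (cases m)
          case 0
          then show ?thesis
            using 3 up st by (simp add: c_def)
        next
          case (Suc l)
          have below: "ht (?b (Suc m)) = ht (?b l)"
            using 3 c less.IH[of m] less.IH[of l] less.prems \<open>n = Suc m\<close> Suc by simp
          \<comment> \<open>A descent lands at the height of \<open>?b l\<close>, and a reflection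
            joins the two points; by QP1 the path has turned back.\<close>
          obtain r where r: "r \<in> reflections G S" "?b (Suc m) = \<phi> r (zig x s t m)"
            using zig_reflection[OF st(2,1,3)] .
          then have "?b (Suc m) = \<phi> r (?b l)"
            using shift Suc by simp
          then have "?b (Suc m) = ?b l"
            using QP1[OF r(1) zig_closed[OF st(2,1,3), of l]] below by simp
          then have turn: "?b m = \<phi> c (?b l)"
            using c st by (metis act_S_twice zig_closed)
          \<comment> \<open>Turning back makes \<open>?b m\<close> equal to a lower point:
            \<open>x\<close> if \<open>l = 0\<close>, otherwise \<open>?b j\<close>, because
            \<open>c\<close> is also the letter used two steps before.\<close>
          show ?thesis
          proof (cases l)
            case 0
            then have "?b m = x"
              using turn Suc fixed st by (simp add: c_def)
            then show ?thesis
              using less.IH[of m] less.prems \<open>n = Suc m\<close> Suc by simp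
          next
            case (Suc j)
            have "?b l = \<phi> c (?b j)"
              using zig_Suc[OF st(2,1,3), of j] Suc \<open>m = Suc l\<close> by (simp add: c_def)
            then have "?b m = ?b j"
              using turn c st by (metis act_S_twice zig_closed)
            then show ?thesis
              using less.IH[of m] less.IH[of j] less.prems \<open>n = Suc m\<close> \<open>m = Suc l\<close> Suc by simp
          qed
        qed
      qed
    qed
  qed
  define c where "c = alt_letter t s k"
  have eval: "foldr (hecke_op q) (alt t s k) g x = g (?b k)" for g
    using rise st by (intro foldr_hecke_ascending) auto
  have "\<phi> c (?b k) = ?b k"
    using zig_Suc[OF st(2,1,3), of k] meet shift[of k] by (simp add: c_def)
  then have "foldr (hecke_op q) (alt t s (Suc k)) f x = q * f (?b k)"
    by (simp only: alt_snoc) (simp add: eval hecke_op_def flip: c_def)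
  moreover have "foldr (hecke_op q) (alt s t (Suc k)) f x = q * f (?b k)"
    using fixed eval by (simp add: hecke_op_def)
  ultimately show ?thesis
    by simp
qed

lemma braid_at_minimum:
  assumes st: "s \<in> S" "t \<in> S" "x \<in> X"
    and up: "ht x \<le> ht (\<phi> s x)" "ht x \<le> ht (\<phi> t x)"
    and k: "0 < k" "zig x s t k = zig x t s k"
    and least: "\<And>n. \<lbrakk>0 < n; n < k\<rbrakk> \<Longrightarrow> zig x s t n \<noteq> zig x t s n"
  shows "foldr (hecke_op q) (alt s t k) f x = foldr (hecke_op q) (alt t s k) f x"
proof -
  obtain j where j: "k = Suc j"
    using k by (cases k) auto
  consider "\<phi> s x = x" | "\<phi> t x = x" | "ht x < ht (\<phi> s x)" "ht x < ht (\<phi> t x)"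
    using ht_cases[OF st(1,3)] ht_cases[OF st(2,3)] up by (metis QP1 S_reflection order_le_less st)
  then show ?thesis
  proof cases
    case 1
    then show ?thesis
      using braid_at_minimum_path[of s t x j] assms j by metis
  next
    case 2
    then show ?thesis
      using braid_at_minimum_path[of t s x j] assms j by metis
  next
    case 3
    then show ?thesis
      using braid_at_minimum_cycle[of s t x k] assms by metis
  qed
qed

text \<open>If \<open>s\<close> moves \<open>x\<close>, the values of \<open>g\<close> and
  \<open>hecke_op q s g\<close> at \<open>x\<close> determine \<open>g (\<phi> s x)\<close>, whose
  coefficient is 1 or \<open>q\<close>. So it suffices to compare both sides at \<open>x\<close>
  after one more \<open>hecke_op q s\<close>.\<close>

lemma braid_step:
  fixes q :: "'r::idom"
  assumes st: "s \<in> S" "t \<in> S" "x \<in> X" and "q \<noteq> 0"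
    and braid: "\<And>f. foldr (hecke_op q) (alt s t m) f x = foldr (hecke_op q) (alt t s m) f x"
  shows "foldr (hecke_op q) (alt s t m) f (\<phi> s x) = foldr (hecke_op q) (alt t s m) f (\<phi> s x)"
proof (cases m)
  case (Suc k)
  let ?T = "hecke_op q" and ?P = "foldr (hecke_op q) (alt s t m)" and ?Q = "foldr (hecke_op q) (alt t s m)"
  let ?R = "foldr (hecke_op q) (alt t s k)"
  define b where "b = alt_letter t s k"
  have b: "b \<in> S"
    using st by (simp add: b_def)
  have P: "?P = ?T s \<circ> ?R" and Q: "?Q = ?R \<circ> ?T b" and PQ: "?P \<circ> ?T b = ?T s \<circ> ?Q"
  proof -
    show "?P = ?T s \<circ> ?R"
      using Suc by simp
    show "?Q = ?R \<circ> ?T b"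
      using Suc unfolding b_def by (intro ext) (simp only: alt_snoc foldr_append foldr.simps comp_apply id_apply)
    have "alt s t (Suc m) = alt s t m @ [b]"
      unfolding alt_snoc[of s t m] by (simp add: b_def Suc)
    then have "?P \<circ> ?T b = foldr ?T (alt s t (Suc m))"
      by (intro ext) (simp only: foldr_append foldr.simps comp_apply id_apply)
    then show "?P \<circ> ?T b = ?T s \<circ> ?Q"
      by simp
  qed
  \<comment> \<open>The quadratic relation for \<open>s\<close> is expanded, the braid relation is
    applied at \<open>x\<close>, and the quadratic relation for \<open>b\<close> is folded
    back.\<close>
  have "?T s (?P f) x = (q - 1) * ?P f x + q * ?R f x"
    using hecke_op_square[OF st(1), of q "?R f"] by (simp add: P)
  also have "\<dots> = (q - 1) * ?Q f x + q * ?R f x"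
    using braid by simp
  also have "\<dots> = ?R (?T b (?T b f)) x"
    by (simp add: hecke_op_square[OF b] foldr_hecke_linear Q)
  also have "\<dots> = ?P (?T b f) x"
    using braid by (simp add: Q)
  also have "\<dots> = ?T s (?Q f) x"
    using PQ by (metis comp_apply)
  finally have *: "?T s (?P f) x = ?T s (?Q f) x" .
  show ?thesis
    using * braid[of f] \<open>q \<noteq> 0\<close> st by (auto simp: hecke_op_def[of q s] split: if_splits)
qed simp

text \<open>Blocks of \<open>k\<close> letters are exchanged one at a time. For odd \<open>k\<close>
  the tail starts with the other letter, and the induction hypothesis is used from right to
  left.\<close>

lemma braid_multiple:
  assumes "\<And>x. x \<in> U \<Longrightarrow> \<phi> s x \<in> U \<and> \<phi> t x \<in> U"
    and braid: "\<And>x f. x \<in> U \<Longrightarrow>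
      foldr (hecke_op q) (alt s t k) f x = foldr (hecke_op q) (alt t s k) f x"
    and "x \<in> U"
  shows "foldr (hecke_op q) (alt s t (k * j)) f x = foldr (hecke_op q) (alt t s (k * j)) f x"
  using assms(3)
proof (induction j arbitrary: x f)
  case (Suc j)
  let ?s = "alt_letter s t k" and ?t = "alt_letter t s k"
  have "foldr (hecke_op q) (alt s t (k * Suc j)) f x =
      foldr (hecke_op q) (alt s t k) (foldr (hecke_op q) (alt ?s ?t (k * j)) f) x"
    by (simp only: mult_Suc_right alt_add foldr_append)
  also have "\<dots> = foldr (hecke_op q) (alt t s k) (foldr (hecke_op q) (alt ?s ?t (k * j)) f) x"
    using braid Suc.prems by blast
  also have "\<dots> = foldr (hecke_op q) (alt t s k) (foldr (hecke_op q) (alt ?t ?s (k * j)) f) x"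
  proof (rule foldr_hecke_cong[where U = U])
    show "\<phi> r y \<in> U" if "r \<in> set (alt t s k)" "y \<in> U" for r y
      using that assms(1) set_alt[of t s k] by auto
    show "foldr (hecke_op q) (alt ?s ?t (k * j)) f y = foldr (hecke_op q) (alt ?t ?s (k * j)) f y"
      if "y \<in> U" for y
      using Suc.IH[OF that] by simp
  qed (use Suc.prems in simp)
  also have "\<dots> = foldr (hecke_op q) (alt t s (k * Suc j)) f x"
    by (simp only: mult_Suc_right alt_add foldr_append)
  finally show ?case .
qed simp

text \<open>By \<open>zig_eq_iff\<close>, \<open>k\<close> is the size of the orbit of
  \<open>x\<close> under \<open>s \<otimes> t\<close>. The remainder of \<open>m\<close> modulo
  \<open>k\<close> is again a meeting index, hence zero by leastness.\<close>

lemma zig_period_dvd: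
  assumes st: "s \<in> S" "t \<in> S" "x \<in> X"
    and k: "0 < k" "zig x s t k = zig x t s k"
    and least: "\<And>n. \<lbrakk>0 < n; n < k\<rbrakk> \<Longrightarrow> zig x s t n \<noteq> zig x t s n"
    and m: "zig x s t m = zig x t s m"
  shows "k dvd m"
proof -
  let ?z = "s \<otimes> t"
  have z: "?z \<in> carrier G"
    using st by simp
  have add: "\<phi> (?z [^] (i + j)) x = \<phi> (?z [^] i) (\<phi> (?z [^] j) x)" for i j :: nat
    using z st nat_pow_mult[of ?z i j] composition_rule by (metis nat_pow_closed)
  have "\<phi> (?z [^] (d * k)) x = x" for d
    by (induction d) (use add st k zig_eq_iff in auto)
  then have "\<phi> (?z [^] (m mod k)) x = x"
    using add[of "m mod k" "m div k * k"] m zig_eq_iff[OF st] by simp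
  then have "zig x s t (m mod k) = zig x t s (m mod k)"
    using zig_eq_iff[OF st] by simp
  then have "m mod k = 0"
    using least[of "m mod k"] k(1) by (meson bot_nat_0.not_eq_extremum mod_less_divisor)
  then show ?thesis
    by auto
qed

theorem hecke_braid:
  fixes q :: "'r::idom"
  assumes "finite X" "q \<noteq> 0" and st: "s \<in> S" "t \<in> S" and m: "(s \<otimes> t) [^] (m::nat) = \<one>"
  shows "foldr (hecke_op q) (alt s t m) = foldr (hecke_op q) (alt t s m)"
proof (intro ext)
  fix f y
  \<comment> \<open>The orbit of \<open>y\<close> under the dihedral subgroup; words suffice since
    the letters are involutions.\<close>
  let ?U = "{\<phi> (word_prod G ws) y | ws. ws \<in> lists {s, t}}"
  show "foldr (hecke_op q) (alt s t m) f y = foldr (hecke_op q) (alt t s m) f y"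
  proof (cases "y \<in> X \<and> m \<noteq> 0")
    case True
    then have y: "y \<in> X" by simp
    have words: "word_prod G ws \<in> carrier G" if "ws \<in> lists {s, t}" for ws
      using that st by (intro word_prod_closed) auto
    then have sub: "?U \<subseteq> X"
      using y by auto
    have step_closed: "\<phi> r z \<in> ?U" if z: "z \<in> ?U" and r: "r \<in> {s, t}" for r z
    proof -
      obtain ws where "ws \<in> lists {s, t}" "z = \<phi> (word_prod G ws) y"
        using z by auto
      then have "\<phi> r z = \<phi> (word_prod G (r # ws)) y" "r # ws \<in> lists {s, t}"
        using r st y words[of ws] composition_rule[of y r] by auto
      then show ?thesis
        by blast
    qed
    have "y \<in> ?U"
      using y by (auto intro!: exI[of _ "[]"])
    moreover have fin: "finite ?U"
      using sub assms(1) finite_subset by blast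
    ultimately obtain x where x: "x \<in> ?U" "\<And>z. z \<in> ?U \<Longrightarrow> ht x \<le> ht z"
      using arg_min_if_finite[of ?U ht] arg_min_least[of ?U _ ht] by blast
    then have xX: "x \<in> X"
      using sub by (meson subsetD)
    have up: "ht x \<le> ht (\<phi> s x)" "ht x \<le> ht (\<phi> t x)"
      by (rule x(2)[OF step_closed[OF x(1)]], simp)+
    have meet_m: "zig x s t m = zig x t s m"
      using zig_eq_iff[OF st xX] m xX by simp
    define k where "k = (LEAST n. 0 < n \<and> zig x s t n = zig x t s n)"
    have k: "0 < k" "zig x s t k = zig x t s k"
      using LeastI[of "\<lambda>n. 0 < n \<and> zig x s t n = zig x t s n" m] meet_m True by (auto simp: k_def)
    have least: "zig x s t n \<noteq> zig x t s n" if "0 < n" "n < k" for n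
      using not_less_Least[of n] that by (auto simp: k_def)
    \<comment> \<open>The braid relation of length \<open>k\<close> holds at the lowest point
      \<open>x\<close>; \<open>braid_step\<close> carries it within this set back to
      \<open>y\<close>.\<close>
    define K where "K = {z \<in> X. \<forall>f. foldr (hecke_op q) (alt s t k) f z = foldr (hecke_op q) (alt t s k) f z}"
    have K_step: "\<phi> r z \<in> K" if "z \<in> K" "r \<in> {s, t}" for r z
      using that braid_step[of s t z q k] braid_step[of t s z q k] st assms(2) by (auto simp: K_def)
    have "x \<in> K"
      unfolding K_def using xX braid_at_minimum[OF st xX up k least, where q = q] by blast
    moreover obtain ws where "ws \<in> lists {s, t}" "x = \<phi> (word_prod G ws) y"
      using x by auto
    ultimately have "y \<in> K"
    proof (induction ws arbitrary: x)
      case Nil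
      then show ?case using y by simp
    next
      case (Cons r ws)
      then have r: "r \<in> {s, t}" "ws \<in> lists {s, t}"
        by auto
      then have "x = \<phi> r (\<phi> (word_prod G ws) y)"
        using Cons st y words composition_rule[of y r "word_prod G ws"] by auto
      then have "\<phi> r x = \<phi> (word_prod G ws) y"
        using r st y words[OF r(2)] by auto
      then show ?case
        using Cons.IH K_step Cons.prems r by metis
    qed
    obtain j where j: "m = k * j"
      using zig_period_dvd[of s t x k m] st xX k least meet_m by (metis dvdE)
    show ?thesis
      unfolding j
    proof (rule braid_multiple[where U = K])
      show "\<phi> s z \<in> K \<and> \<phi> t z \<in> K" if "z \<in> K" for z
        using K_step that by blast
      show "foldr (hecke_op q) (alt s t k) g z = foldr (hecke_op q) (alt t s k) g z" if "z \<in> K" for z g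
        using that by (simp add: K_def)
    qed fact
  qed (auto simp: foldr_hecke_outside)
qed

end

section \<open>The total symmetrizer\<close>

text \<open>Passing between \<open>foldr\<close> and \<open>fold\<close> reverses words. This swaps
  the two alternating words for even \<open>n\<close> and keeps each for odd \<open>n\<close>, so
  the braid relation keeps its form.\<close>

lemma rev_alt: "rev (alt s t n) = alt (alt_letter t s n) (alt_letter s t n) n"
proof (induction n arbitrary: s t)
  case (Suc n)
  have "rev (alt s t (Suc n)) = alt_letter s t n # rev (alt s t n)"
    by (simp only: alt_snoc rev_append) simp
  then show ?case
    using Suc by simp
qed simp

locale finite_quasiparabolic_set = quasiparabolic_set G S X \<phi> ht
  for G :: "('a, 'b) monoid_scheme" (structure) and S and X :: "'x set" and \<phi> and ht +
  assumes finite_G: "finite (carrier G)" and finite_X: "finite X"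
begin

lemma fold_hecke_linear:
  "fold (hecke_op q) ws (\<lambda>x. a * f x + b * g x) =
    (\<lambda>x. a * fold (hecke_op q) ws f x + b * fold (hecke_op q) ws g x)"
  using foldr_hecke_linear[of q "rev ws" a f b g] by (simp add: foldr_conv_fold)

definition reduced_word :: "'a \<Rightarrow> 'a list" where
  "reduced_word w = (SOME ws. reduced ws \<and> word_prod G ws = w)"

lemma reduced_word:
  assumes "w \<in> carrier G"
  shows "reduced (reduced_word w)" "word_prod G (reduced_word w) = w"
  using someI_ex[OF ex_reduced[OF assms]] by (simp_all add: reduced_word_def)

text \<open>With \<open>fold\<close> the first letter acts first, so prepending a letter to the word
  composes with its operator on the inside.\<close>

definition hecke_elt :: "'r::idom \<Rightarrow> 'a \<Rightarrow> ('x \<Rightarrow> 'r) \<Rightarrow> 'x \<Rightarrow> 'r" where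
  "hecke_elt q w = fold (hecke_op q) (reduced_word w)"

text \<open>By \<open>matsumoto\<close> and \<open>hecke_braid\<close> all reduced words of
  \<open>s \<otimes> w\<close> give the same operator, and \<open>s # reduced_word w\<close> is one
  of them.\<close>

lemma hecke_elt_ascent:
  assumes "q \<noteq> 0" "s \<in> S" "w \<in> carrier G" "len w < len (s \<otimes> w)"
  shows "hecke_elt q w (hecke_op q s f) = hecke_elt q (s \<otimes> w) f"
proof -
  have "fold (hecke_op q) (s # reduced_word w) = fold (hecke_op q) (reduced_word (s \<otimes> w))"
  proof (rule matsumoto)
    fix s t and n :: nat
    assume "s \<in> S" "t \<in> S" "(s \<otimes> t) [^] n = \<one>"
    then have "foldr (hecke_op q) (alt s t n) = foldr (hecke_op q) (alt t s n)"
      using hecke_braid finite_X assms(1) by blast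
    then show "fold (hecke_op q) (alt s t n) = fold (hecke_op q) (alt t s n)"
      by (simp add: foldr_conv_fold rev_alt split: if_splits)
  qed (use assms reduced_word reduced_ConsI in auto)
  then show ?thesis
    by (metis hecke_elt_def fold_simps(2))
qed

text \<open>Here \<open>w\<close> is \<open>s\<close> times the shorter element
  \<open>s \<otimes> w\<close>, and the quadratic relation applies to the doubled
  \<open>s\<close>.\<close>

lemma hecke_elt_descent:
  assumes "q \<noteq> 0" "s \<in> S" "w \<in> carrier G" "len (s \<otimes> w) < len w"
  shows "hecke_elt q w (hecke_op q s f) x = (q - 1) * hecke_elt q w f x + q * hecke_elt q (s \<otimes> w) f x"
proof -
  have up: "hecke_elt q (s \<otimes> w) (hecke_op q s g) = hecke_elt q w g" for g
    using hecke_elt_ascent[of q s "s \<otimes> w"] assms by simp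
  have "hecke_elt q w (hecke_op q s f) = hecke_elt q (s \<otimes> w) (\<lambda>x. (q - 1) * hecke_op q s f x + q * f x)"
    using up[of "hecke_op q s f"] hecke_op_square[OF assms(2), of q f] by simp
  then show ?thesis
    using up[of f] by (simp add: hecke_elt_def fold_hecke_linear)
qed

definition symmetrizer :: "'r::idom \<Rightarrow> ('x \<Rightarrow> 'r) \<Rightarrow> 'x \<Rightarrow> 'r" where
  "symmetrizer q f x = (\<Sum>w\<in>carrier G. hecke_elt q w f x)"

text \<open>Left multiplication by \<open>s\<close> swaps the ascents \<open>U\<close> and the
  descents \<open>V\<close>. The ascents contribute the sum over \<open>V\<close>; the descents
  contribute \<open>q - 1\<close> times the sum over \<open>V\<close> plus \<open>q\<close> times
  the sum over \<open>U\<close>.\<close>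

lemma symmetrizer_hecke_op:
  fixes q :: "'r::idom"
  assumes "q \<noteq> 0" "s \<in> S"
  shows "symmetrizer q (hecke_op q s f) x = q * symmetrizer q f x"
proof -
  define U V where "U = {w \<in> carrier G. len w < len (s \<otimes> w)}"
    and "V = {w \<in> carrier G. len (s \<otimes> w) < len w}"
  have UV: "carrier G = U \<union> V" "U \<inter> V = {}"
    using len_mult_neq[OF assms(2)] by (auto simp: U_def V_def neq_iff)
  have fin: "finite U" "finite V"
    using finite_G by (auto simp: U_def V_def)
  have split: "(\<Sum>w\<in>carrier G. g w) = (\<Sum>w\<in>U. g w) + (\<Sum>w\<in>V. g w)" for g :: "'a \<Rightarrow> 'r"
    using UV fin by (simp add: sum.union_disjoint)
  have swap: "(\<Sum>w\<in>U. g (s \<otimes> w)) = (\<Sum>w\<in>V. g w)" "(\<Sum>w\<in>V. g (s \<otimes> w)) = (\<Sum>w\<in>U. g w)"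
    for g :: "'a \<Rightarrow> 'r"
    by (rule sum.reindex_bij_witness[of _ "\<lambda>w. s \<otimes> w" "\<lambda>w. s \<otimes> w"];
        use assms(2) in \<open>auto simp: U_def V_def\<close>)+
  let ?h = "\<lambda>w. hecke_elt q w f x"
  have "symmetrizer q (hecke_op q s f) x = (\<Sum>w\<in>U. ?h (s \<otimes> w)) + (\<Sum>w\<in>V. (q - 1) * ?h w + q * ?h (s \<otimes> w))"
    unfolding symmetrizer_def split using assms
    by (intro arg_cong2[of _ _ _ _ "(+)"] sum.cong)
      (auto simp: U_def V_def hecke_elt_ascent hecke_elt_descent)
  also have "\<dots> = (\<Sum>w\<in>V. ?h w) + ((q - 1) * (\<Sum>w\<in>V. ?h w) + q * (\<Sum>w\<in>U. ?h w))"
    using swap(2)[of ?h] by (simp add: swap(1)[of ?h] sum.distrib flip: sum_distrib_left)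
  also have "\<dots> = q * symmetrizer q f x"
    unfolding symmetrizer_def split by (simp add: algebra_simps)
  finally show ?thesis .
qed

lemma symmetrizer_linear:
  "symmetrizer q (\<lambda>x. a * f x + b * g x) y = a * symmetrizer q f y + b * symmetrizer q g y"
proof -
  have "hecke_elt q w (\<lambda>x. a * f x + b * g x) y = a * hecke_elt q w f y + b * hecke_elt q w g y" for w
    using fold_hecke_linear[of q "reduced_word w" a f b g] by (simp add: hecke_elt_def)
  then show ?thesis
    by (simp add: symmetrizer_def sum.distrib sum_distrib_left)
qed

lemma symmetrizer_scale: "symmetrizer q (\<lambda>x. a * f x) y = a * symmetrizer q f y"
  using symmetrizer_linear[of q a f 0 f y] by simp

lemma symmetrizer_sum:
  assumes "finite A"
  shows "symmetrizer q (\<lambda>x. \<Sum>i\<in>A. c i * g i x) y = (\<Sum>i\<in>A. c i * symmetrizer q (g i) y)"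
  using assms
proof (induction A)
  case empty
  then show ?case
    using symmetrizer_scale[of q 0 "\<lambda>_. 0" y] by simp
next
  case (insert i A)
  then show ?case
    using symmetrizer_linear[of q "c i" "g i" 1 "\<lambda>x. \<Sum>i\<in>A. c i * g i x" y] by simp
qed

section \<open>Indicator functions and the eigenfunction of heights\<close>

abbreviation delta :: "'x \<Rightarrow> 'x \<Rightarrow> 'r::idom" where
  "delta y \<equiv> (\<lambda>x. if x = y then 1 else 0)"

text \<open>The operator of \<open>s\<close> sends \<open>delta y\<close> to \<open>q\<close> times
  \<open>delta (\<phi> s y)\<close>, while the symmetrizer absorbs it as a factor \<open>q\<close>;
  this factor cancels.\<close>

lemma symmetrizer_delta_ascent:
  fixes q :: "'r::idom"
  assumes "q \<noteq> 0" "s \<in> S" "y \<in> X" "ht y < ht (\<phi> s y)"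
  shows "symmetrizer q (delta (\<phi> s y)) x = symmetrizer q (delta y) x"
proof -
  have "hecke_op q s (delta y) z = q * delta (\<phi> s y) z" for z
    using assms act_S_twice[of s z] act_S_twice[of s y] by (auto simp: hecke_op_def)
  then have "hecke_op q s (delta y) = (\<lambda>z. q * delta (\<phi> s y) z)"
    by blast
  then have "q * symmetrizer q (delta (\<phi> s y)) x = q * symmetrizer q (delta y) x"
    using symmetrizer_hecke_op[OF assms(1,2), of "delta y" x]
      symmetrizer_scale[of q q "delta (\<phi> s y)" x] by metis
  then show ?thesis
    using assms(1) by simp
qed

lemma symmetrizer_delta:
  fixes q :: "'r::idom"
  assumes "q \<noteq> 0" "g \<in> carrier G" "y \<in> X"
  shows "symmetrizer q (delta (\<phi> g y)) x = symmetrizer q (delta y) x"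
proof -
  have step: "symmetrizer q (delta (\<phi> s z)) x = symmetrizer q (delta z) x" if "s \<in> S" "z \<in> X" for s z
  proof (cases rule: ht_cases[OF that])
    case 2
    then show ?thesis
      using symmetrizer_delta_ascent[OF assms(1) that] by simp
  next
    case 3
    then show ?thesis
      using symmetrizer_delta_ascent[OF assms(1) that(1), of "\<phi> s z"] that by simp
  qed simp
  have "symmetrizer q (delta (\<phi> (word_prod G ws) y)) x = symmetrizer q (delta y) x" if "ws \<in> lists S" for ws
    using that
  proof (induction ws)
    case (Cons s ws)
    then have "\<phi> (word_prod G (s # ws)) y = \<phi> s (\<phi> (word_prod G ws) y)"
      using composition_rule[of y s "word_prod G ws"] assms by auto
    then show ?case
      using Cons step[of s "\<phi> (word_prod G ws) y"] assms by auto
  qed (use assms in simp)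
  then show ?thesis
    using ex_word[OF assms(2)] by blast
qed

text \<open>The weight is a common eigenfunction of the generators with eigenvalue \<open>q\<close>,
  so \<open>hecke_elt q w\<close> multiplies it by \<open>q ^ len w\<close>.\<close>

lemma symmetrizer_weight:
  fixes q :: "'r::idom"
  assumes h: "\<And>x. x \<in> X \<Longrightarrow> ht x = int (h x)" and "x \<in> X"
  shows "symmetrizer q (\<lambda>x. if x \<in> X then q ^ h x else 0) x = (\<Sum>w\<in>carrier G. q ^ len w) * q ^ h x"
proof -
  let ?e = "\<lambda>x. if x \<in> X then q ^ h x else 0"
  have eigen: "hecke_op q s ?e = (\<lambda>x. q * ?e x)" if "s \<in> S" for s
  proof
    fix x
    show "hecke_op q s ?e x = q * ?e x"
    proof (cases "x \<in> X")
      case True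
      have hs: "ht x = int (h x)" "ht (\<phi> s x) = int (h (\<phi> s x))" "\<phi> s x \<in> X"
        using h that True by auto
      show ?thesis
      proof (cases rule: ht_cases[OF that True])
        case 2
        then have "h (\<phi> s x) = Suc (h x)"
          using hs by simp
        then show ?thesis
          using 2(1) hs True by (simp add: hecke_op_def)
      next
        case 3
        then have "h x = Suc (h (\<phi> s x))"
          using hs by simp
        then show ?thesis
          using 3(1) hs True by (simp add: hecke_op_def algebra_simps)
      qed (use True in \<open>simp add: hecke_op_def\<close>)
    qed (simp add: hecke_op_def)
  qed
  \<comment> \<open>The scalar \<open>c\<close> is general because \<open>fold\<close> changes the
    function before the induction hypothesis applies.\<close>
  have "fold (hecke_op q) ws (\<lambda>x. c * ?e x) = (\<lambda>x. q ^ length ws * c * ?e x)"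
    if "ws \<in> lists S" for ws c
    using that
  proof (induction ws arbitrary: c)
    case (Cons s ws)
    then have s: "s \<in> S"
      by simp
    have "hecke_op q s (\<lambda>x. c * ?e x) = (\<lambda>x. (c * q) * ?e x)"
      using hecke_op_linear[of q s c ?e 0 ?e] eigen[OF s] by (simp add: mult.assoc)
    then have "fold (hecke_op q) (s # ws) (\<lambda>x. c * ?e x) = (\<lambda>x. q ^ length ws * (c * q) * ?e x)"
      using Cons.IH[of "c * q"] Cons.prems by simp
    then show ?case
      by (simp add: mult_ac)
  qed simp
  from this[of _ 1] have "hecke_elt q w ?e x = q ^ len w * q ^ h x" if "w \<in> carrier G" for w
    using reduced_word[OF that] \<open>x \<in> X\<close> by (auto simp: hecke_elt_def reduced_def)
  then show ?thesis
    by (simp add: symmetrizer_def sum_distrib_right)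
qed

theorem poincare_sum_dvd:
  fixes q :: "'r::idom"
  assumes h: "\<And>x. x \<in> X \<Longrightarrow> ht x = int (h x)" and "q \<noteq> 0"
    and x: "x \<in> X" "h x = 0" and trans: "\<And>y. y \<in> X \<Longrightarrow> \<exists>g\<in>carrier G. y = \<phi> g x"
  shows "(\<Sum>y\<in>X. q ^ h y) dvd (\<Sum>w\<in>carrier G. q ^ len w)"
proof
  have decomp: "(\<lambda>z. if z \<in> X then q ^ h z else 0) = (\<lambda>z. \<Sum>y\<in>X. q ^ h y * delta y z)"
    using finite_X by (auto simp: sum.delta if_distrib cong: if_cong)
  \<comment> \<open>As \<open>h x = 0\<close>, the weight at the base point is 1.\<close>
  have "(\<Sum>w\<in>carrier G. q ^ len w) = symmetrizer q (\<lambda>z. if z \<in> X then q ^ h z else 0) x"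
    using symmetrizer_weight[OF h x(1), of q] x by simp
  also have "\<dots> = (\<Sum>y\<in>X. q ^ h y * symmetrizer q (delta y) x)"
    unfolding decomp using finite_X by (rule symmetrizer_sum)
  also have "\<dots> = (\<Sum>y\<in>X. q ^ h y * symmetrizer q (delta x) x)"
  proof (intro sum.cong refl)
    fix y
    assume "y \<in> X"
    then obtain g where "g \<in> carrier G" "y = \<phi> g x"
      using trans by blast
    then show "q ^ h y * symmetrizer q (delta y) x = q ^ h y * symmetrizer q (delta x) x"
      using symmetrizer_delta[OF assms(2) _ x(1)] by simp
  qed
  finally show "(\<Sum>w\<in>carrier G. q ^ len w) = (\<Sum>y\<in>X. q ^ h y) * symmetrizer q (delta x) x"
    by (simp add: sum_distrib_right)
qed

end

section \<open>Application to the cosets of \<open>H\<close>\<close>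

theorem theorem8p1:
  fixes W :: "('a, 'b) monoid_scheme" and S H :: "'a set"
  assumes "coxeter_system W S"
    and "finite (carrier W)"
    and "quasiparabolic_subgroup W S H"
  shows "poincare_poly (lcosets\<^bsub>W\<^esub> H) (coset_ht W S)
           dvd poincare_poly (carrier W) (cox_length W S)"
proof -
  let ?X = "lcosets\<^bsub>W\<^esub> H"
  have H: "subgroup H W"
    and qp: "quasiparabolic_set W S ?X (coset_action W H) (\<lambda>C. int (coset_ht W S C))"
    using assms(3) by (auto simp: quasiparabolic_subgroup_def)
  interpret quasiparabolic_set W S ?X "coset_action W H" "\<lambda>C. int (coset_ht W S C)"
    by (rule qp)
  have "finite ?X"
    using assms(2) by (simp add: LCOSETS_def)
  then interpret finite_quasiparabolic_set W S ?X "coset_action W H" "\<lambda>C. int (coset_ht W S C)"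
    using assms(2) by unfold_locales
  have sub: "H \<subseteq> carrier W"
    using H by (rule subgroup.subset)
  have one: "\<one>\<^bsub>W\<^esub> <#\<^bsub>W\<^esub> H = H"
    using sub by (rule lcos_mult_one)
  then have HX: "H \<in> ?X"
    by (auto simp: LCOSETS_def)
  \<comment> \<open>The base point is the coset \<open>H\<close>, which contains the identity and so
    has height 0.\<close>
  have "coset_ht W S H \<le> 0"
    unfolding coset_ht_def using subgroup.one_closed[OF H] by (intro Least_le bexI[of _ "\<one>\<^bsub>W\<^esub>"]) simp_all
  \<comment> \<open>Taking \<open>q\<close> to be the indeterminate \<open>monom 1 1\<close> gives
    divisibility among integer polynomials.\<close>
  then have "(\<Sum>C\<in>?X. (monom 1 1 :: int poly) ^ coset_ht W S C)
      dvd (\<Sum>w\<in>carrier W. monom 1 1 ^ cox_length W S w)"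
  proof (intro poincare_sum_dvd)
    show "\<exists>g\<in>carrier W. C = coset_action W H g H" if "C \<in> ?X" for C
      using that HX by (auto simp: coset_action_def LCOSETS_def)
  qed (use HX in simp_all)
  then show ?thesis
    by (simp add: poincare_poly_def monom_power)
qed

end
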